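(* (1) Let $\overline{\alpha}\in SP^+$. Then for every $n\in\mathbb{N}$ there are infinitely many convergent denominators $q_k$ of $\overline{\alpha}$ such that $n\mid q_k$. (2) Let $\overline{\alpha}\in ESP^+$ with $\alpha>1$. Then for every $n\in\mathbb{N}$ there are infinitely many convergent denominators $q_k$ of $\overline{\alpha}$ such that $n\mid q_k$.
   Context: $\overline{\alpha}=[a_0;a_1,a_2,\dots]$ denotes the continued fraction expansion of a real number $\alpha$ ($a_0\in\mathbb{Z}$, $a_i\in\mathbb{N}$ for $i\ge1$). Its convergents $\frac{p_k}{q_k}=[a_0;a_1,\dots,a_k]$ are given by $p_{-1}=1,\ p_0=a_0,\ p_k=a_kp_{k-1}+p_{k-2}$ and $q_{-1}=0,\ q_0=1,\ q_k=a_kq_{k-1}+q_{k-2}$; $p_k$ and $q_k$ are the $k$-th convergent numerator and denominator. A bar over a block of partial quotients denotes infinite repetition. A continued fraction is strictly periodic if it has the form $[\overline{a_0;a_1,\dots,a_{s-1}}]$ or $[0;\overline{a_1,\dots,a_s}]$. It is essentially periodic if it has the form $[a_0;\overline{a_1,\dots,a_s}]$ with $a_0\le a_s$, or $[0;a_1,\overline{a_2,\dots,a_{s+1}}]$ with $a_1\le a_{s+1}$. $SP^+$ and $ESP^+$ are the sets of strictly periodic, respectively essentially periodic, continued fractions representing positive numbers. *)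

theory Defs
  imports Complex_Main
begin

text \<open>
  An infinite continued fraction \<open>[a\<^sub>0; a\<^sub>1, a\<^sub>2, \<dots>]\<close> is given by the sequence of its partial
  quotients. Only \<open>a\<^sub>0\<close> may be zero or negative.
\<close>

definition cfrac :: "(nat \<Rightarrow> int) \<Rightarrow> bool" where
  "cfrac a \<longleftrightarrow> (\<forall>i\<ge>1. a i \<ge> 1)"

text \<open>
  The second equation is the step \<open>k = 1\<close> of \<open>p\<^sub>k = a\<^sub>k p\<^sub>k\<^sub>-\<^sub>1 + p\<^sub>k\<^sub>-\<^sub>2\<close> with \<open>p\<^sub>-\<^sub>1 = 1\<close>
  (resp. \<open>q\<^sub>-\<^sub>1 = 0\<close>) inserted, so that the index can be a natural number.
\<close>

fun conv_num :: "(nat \<Rightarrow> int) \<Rightarrow> nat \<Rightarrow> int" where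
  "conv_num a 0 = a 0"
| "conv_num a (Suc 0) = a 1 * a 0 + 1"
| "conv_num a (Suc (Suc k)) = a (Suc (Suc k)) * conv_num a (Suc k) + conv_num a k"

fun conv_denom :: "(nat \<Rightarrow> int) \<Rightarrow> nat \<Rightarrow> int" where
  "conv_denom a 0 = 1"
| "conv_denom a (Suc 0) = a 1 * 1 + 0"
| "conv_denom a (Suc (Suc k)) = a (Suc (Suc k)) * conv_denom a (Suc k) + conv_denom a k"

definition cf_represents :: "(nat \<Rightarrow> int) \<Rightarrow> real \<Rightarrow> bool" where
  "cf_represents a \<alpha> \<longleftrightarrow>
     cfrac a \<and> (\<lambda>k. real_of_int (conv_num a k) / real_of_int (conv_denom a k)) \<longlonglongrightarrow> \<alpha>"

text \<open>
  The two disjuncts are the forms \<open>[\<^bold>(a\<^sub>0; a\<^sub>1, \<dots>, a\<^sub>s\<^sub>-\<^sub>1\<^bold>)]\<close> and \<open>[0; \<^bold>(a\<^sub>1, \<dots>, a\<^sub>s\<^bold>)]\<close>, where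
  the bold parentheses enclose the repeated block; \<open>s\<close> need not be the minimal period.
\<close>

definition strictly_periodic :: "(nat \<Rightarrow> int) \<Rightarrow> bool" where
  "strictly_periodic a \<longleftrightarrow> cfrac a \<and> (\<exists>s\<ge>1.
     (\<forall>i. a (i + s) = a i) \<or>
     (a 0 = 0 \<and> (\<forall>i\<ge>1. a (i + s) = a i)))"

text \<open>
  Likewise for \<open>[a\<^sub>0; \<^bold>(a\<^sub>1, \<dots>, a\<^sub>s\<^bold>)]\<close> with \<open>a\<^sub>0 \<le> a\<^sub>s\<close>, and
  \<open>[0; a\<^sub>1, \<^bold>(a\<^sub>2, \<dots>, a\<^sub>s\<^sub>+\<^sub>1\<^bold>)]\<close> with \<open>a\<^sub>1 \<le> a\<^sub>s\<^sub>+\<^sub>1\<close>.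
\<close>

definition essentially_periodic :: "(nat \<Rightarrow> int) \<Rightarrow> bool" where
  "essentially_periodic a \<longleftrightarrow> cfrac a \<and> (\<exists>s\<ge>1.
     ((\<forall>i\<ge>1. a (i + s) = a i) \<and> a 0 \<le> a s) \<or>
     (a 0 = 0 \<and> (\<forall>i\<ge>2. a (i + s) = a i) \<and> a 1 \<le> a (s + 1)))"

definition SP_plus :: "(nat \<Rightarrow> int) set" where
  "SP_plus = {a. strictly_periodic a \<and> (\<exists>\<alpha>>0. cf_represents a \<alpha>)}"

definition ESP_plus :: "(nat \<Rightarrow> int) set" where
  "ESP_plus = {a. essentially_periodic a \<and> (\<exists>\<alpha>>0. cf_represents a \<alpha>)}"

end

theory Submission
  imports Defs
begin

text \<open>
  In each of the cases the partial quotients are periodic from \<open>a\<^sub>1\<close> on: the second form of an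
  essentially periodic continued fraction represents a number at most 1. The recursion for
  \<open>(q\<^sub>k\<^sub>-\<^sub>1, q\<^sub>k)\<close> can be run backwards, also modulo \<open>n\<close>. By the pigeonhole principle infinitely many of
  these pairs, at indices divisible by the period, agree modulo \<open>n\<close> with one of them; running the
  recursion back from there to \<open>q\<^sub>-\<^sub>1 = 0\<close> turns each coincidence into a denominator divisible by \<open>n\<close>.
\<close>

lemma conv_denom_ge_index:
  assumes "cfrac a"
  shows "1 \<le> conv_denom a k \<and> int k \<le> conv_denom a k"
  using assms
proof (induction a k rule: conv_denom.induct)
  case (3 a k)
  then have "a (Suc (Suc k)) \<ge> 1" by (auto simp: cfrac_def)
  then have "1 * conv_denom a (Suc k) \<le> a (Suc (Suc k)) * conv_denom a (Suc k)"
    using 3 by (intro mult_right_mono) auto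
  moreover have "1 + int k \<le> conv_denom a (Suc k)" "1 \<le> conv_denom a k"
    using 3 by auto
  ultimately show ?case unfolding conv_denom.simps by linarith
qed (auto simp: cfrac_def)

text \<open>Different indices can give the same denominator (\<open>a 1 = 1\<close> makes the first
  two equal), so arbitrarily large indices yield infinitely many values only through the growth
  bound \<open>int k \<le> conv_denom a k\<close>.\<close>

lemma infinite_conv_denom:
  assumes "cfrac a" and unbounded: "\<And>m. \<exists>k\<ge>m. P (conv_denom a k)"
  shows "infinite {conv_denom a k | k. P (conv_denom a k)}" (is "infinite ?S")
proof
  assume "finite ?S"
  then obtain M where M: "\<And>x. x \<in> ?S \<Longrightarrow> x \<le> M"
    by (meson finite_int_segment bdd_above_finite bdd_above_def)
  obtain k where k: "k \<ge> nat (M + 1)" "P (conv_denom a k)"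
    using unbounded by blast
  then have "conv_denom a k \<le> M" by (intro M) blast
  moreover have "int k \<le> conv_denom a k" using conv_denom_ge_index[OF assms(1)] by blast
  ultimately show False using k(1) by linarith
qed

text \<open>Since \<open>b\<close> has period \<open>d\<close>, the differences
  \<open>r (k + d) - r k\<close> obey the recurrence of \<open>r\<close>. Its last term has
  coefficient 1, so divisibility of two neighbouring differences descends to the one before without
  dividing modulo \<open>n\<close>.\<close>

lemma recurrence_mod_backwards:
  fixes r b :: "nat \<Rightarrow> int"
  assumes rec: "\<And>k. r (Suc (Suc k)) = b k * r (Suc k) + r k"
    and per: "\<And>k. b (k + d) = b k"
    and "n dvd r (x + d) - r x" "n dvd r (Suc x + d) - r (Suc x)"
  shows "n dvd r d - r 0"
  using assms(3,4)
proof (induction x)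
  case (Suc x)
  have "r (x + d) - r x =
      (r (Suc (Suc x) + d) - r (Suc (Suc x))) - b x * (r (Suc x + d) - r (Suc x))"
    using rec[of "x + d"] rec[of x] per[of x] by (simp add: algebra_simps)
  then have "n dvd r (x + d) - r x" using Suc.prems by (metis dvd_diff dvd_mult)
  then show ?case using Suc by blast
qed simp

lemma recurrence_infinitely_often_dvd:
  fixes r b :: "nat \<Rightarrow> int"
  assumes rec: "\<And>k. r (Suc (Suc k)) = b k * r (Suc k) + r k"
    and per: "\<And>k. b (k + s) = b k" and "s \<ge> 1" and "r 0 = 0" and "n > 0"
  shows "\<exists>k\<ge>m. n dvd r k"
proof -
  define f where "f j = (r (j * s) mod n, r (Suc (j * s)) mod n)" for j
  have "range f \<subseteq> {0..<n} \<times> {0..<n}" using \<open>n > 0\<close> by (auto simp: f_def)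
  then have "finite (range f)" by (rule finite_subset) simp
  then obtain i where "infinite {j. f j = f i}"
    using pigeonhole_infinite[of UNIV f] by auto
  \<comment> \<open>Taking \<open>j\<close> beyond \<open>i + m\<close> makes the resulting index
    \<open>(j - i) * s\<close> at least \<open>m\<close>.\<close>
  then obtain j where j: "j > i + m" "f j = f i"
    by (auto simp: finite_nat_set_iff_bounded_le not_le)
  define d where "d = (j - i) * s"
  have "b (k + l * s) = b k" for k l
    by (induction l) (use per[of "k + _ * s"] in \<open>auto simp: algebra_simps\<close>)
  then have per_d: "b (k + d) = b k" for k by (simp add: d_def)
  have "i * s + d = j * s" using j(1) by (simp add: d_def flip: add_mult_distrib)
  then have "n dvd r (i * s + d) - r (i * s)" "n dvd r (Suc (i * s) + d) - r (Suc (i * s))"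
    using j(2) by (auto simp: f_def mod_eq_dvd_iff)
  from recurrence_mod_backwards[OF rec per_d this] have "n dvd r d" using \<open>r 0 = 0\<close> by simp
  moreover have "(j - i) * 1 \<le> d" unfolding d_def using \<open>s \<ge> 1\<close> by (intro mult_le_mono) auto
  then have "d \<ge> m" using j(1) by linarith
  ultimately show ?thesis by blast
qed

lemma infinite_conv_denom_dvd:
  assumes "cfrac a" and per: "\<And>i. i \<ge> 1 \<Longrightarrow> a (i + s) = a i" and "s \<ge> 1" and "n > 0"
  shows "infinite {conv_denom a k | k. n dvd conv_denom a k}"
proof (rule infinite_conv_denom[OF assms(1)])
  fix m
  \<comment> \<open>Indices are shifted by one so that \<open>q\<^sub>-\<^sub>1 = 0\<close> is included.\<close>
  define r where "r k = (case k of 0 \<Rightarrow> 0 | Suc j \<Rightarrow> conv_denom a j)" for k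
  have rec: "r (Suc (Suc k)) = a (Suc k) * r (Suc k) + r k" for k
    by (cases k) (auto simp: r_def)
  have per': "a (Suc (k + s)) = a (Suc k)" for k using per[of "Suc k"] by simp
  \<comment> \<open>\<open>Suc m\<close> makes up for the shift and excludes \<open>r 0 = 0\<close>,
    which is divisible by \<open>n\<close> but comes from no \<open>conv_denom a j\<close>.\<close>
  obtain k where "k \<ge> Suc m" "n dvd r k"
    using recurrence_infinitely_often_dvd[of r "\<lambda>k. a (Suc k)" s n "Suc m", OF rec per' assms(3) _ assms(4)]
    by (auto simp: r_def)
  then show "\<exists>k\<ge>m. n dvd conv_denom a k"
    by (cases k) (auto simp: r_def)
qed

text \<open>Both sequences follow the same recursion with positive coefficients, and the starting
  values 0, 1 of the numerators are at most 1, \<open>a 1\<close>.\<close>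

lemma conv_num_le_conv_denom:
  assumes "cfrac a" "a 0 = 0"
  shows "conv_num a k \<le> conv_denom a k"
  using assms
proof (induction a k rule: conv_num.induct)
  case (3 a k)
  then have "a (Suc (Suc k)) * conv_num a (Suc k) \<le> a (Suc (Suc k)) * conv_denom a (Suc k)"
    by (intro mult_left_mono) (auto simp: cfrac_def intro: order_trans[of 0 1])
  with 3 show ?case by auto
qed (auto simp: cfrac_def)

lemma cf_represents_le_1:
  assumes "cf_represents a \<alpha>" "a 0 = 0"
  shows "\<alpha> \<le> 1"
proof (rule LIMSEQ_le_const2)
  show "(\<lambda>k. real_of_int (conv_num a k) / real_of_int (conv_denom a k)) \<longlonglongrightarrow> \<alpha>"
    using assms by (simp add: cf_represents_def)
  have "cfrac a" using assms by (simp add: cf_represents_def)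
  then have "real_of_int (conv_num a k) / real_of_int (conv_denom a k) \<le> 1" for k
    using conv_denom_ge_index[of a k] conv_num_le_conv_denom[of a k] assms(2) by simp
  then show "\<exists>N. \<forall>k\<ge>N. real_of_int (conv_num a k) / real_of_int (conv_denom a k) \<le> 1"
    by blast
qed

theorem theorem3p6:
  shows "(\<forall>a \<in> SP_plus. \<forall>n::nat. n \<ge> 1 \<longrightarrow>
            infinite {conv_denom a k | k. int n dvd conv_denom a k}) \<and>
         (\<forall>a \<in> ESP_plus. \<forall>\<alpha>::real. cf_represents a \<alpha> \<and> \<alpha> > 1 \<longrightarrow>
            (\<forall>n::nat. n \<ge> 1 \<longrightarrow>
              infinite {conv_denom a k | k. int n dvd conv_denom a k}))"
proof (intro conjI ballI allI impI)
  fix a and n :: nat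
  assume "a \<in> SP_plus" and n: "n \<ge> 1"
  then obtain s where "cfrac a" "s \<ge> 1" "\<And>i. i \<ge> 1 \<Longrightarrow> a (i + s) = a i"
    unfolding SP_plus_def strictly_periodic_def by blast
  then show "infinite {conv_denom a k | k. int n dvd conv_denom a k}"
    using n by (intro infinite_conv_denom_dvd) auto
next
  fix a and \<alpha> :: real and n :: nat
  assume a: "a \<in> ESP_plus" and \<alpha>: "cf_represents a \<alpha> \<and> \<alpha> > 1" and n: "n \<ge> 1"
  \<comment> \<open>This discards the form whose period is only known to start at
    \<open>a 2\<close>.\<close>
  have "a 0 \<noteq> 0" using cf_represents_le_1[of a \<alpha>] \<alpha> by auto
  with a obtain s where "cfrac a" "s \<ge> 1" "\<And>i. i \<ge> 1 \<Longrightarrow> a (i + s) = a i"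
    unfolding ESP_plus_def essentially_periodic_def by blast
  then show "infinite {conv_denom a k | k. int n dvd conv_denom a k}"
    using n by (intro infinite_conv_denom_dvd) auto
qed

end
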